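(* Let $W$ be a mixing matrix satisfying the assumption on $W$ stated in the context, let $\gamma\in(0,1]$, and let $\{x_{i,k}\}$ be generated by $$x_{i,k+1}=\mathcal P_{\mathcal M}\Big((1-\gamma)x_{i,k}+\gamma\sum_{j=1}^n W_{ij}x_{j,k}\Big),\qquad i=1,\dots,n,\ k\ge 0.$$ Suppose that $\mathbf x_0\in\mathcal N(\delta)$ with $\delta<\min\{R\gamma(1-\sigma_2),\frac R4\}$. Then $\{\mathbf x_k\}$ converges to the consensus set linearly with rate $$\rho_1:=\frac{R-R\gamma(1-\sigma_2)}{R-\delta}<1.$$ More specifically, for any $k\ge 0$, $$\|\mathbf x_{k+1}-\bar{\mathbf x}_{k+1}\|\le\rho_1\|\mathbf x_k-\bar{\mathbf x}_k\|.$$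
   Context: $\mathcal M\subset\mathbb R^{d\times r}$ is a compact smooth embedded submanifold, $\|\cdot\|$ is the Euclidean (Frobenius) norm, $\mathrm{dist}(x,\mathcal M)=\inf_{y\in\mathcal M}\|y-x\|$, and $\mathcal P_{\mathcal M}(x)=\arg\min_{y\in\mathcal M}\|y-x\|$ is the nearest-point projection (any nearest point is taken where it is not unique). Throughout, $\mathcal M$ is $R$-proximally smooth for some $R>0$: $\mathcal P_{\mathcal M}(x)$ is a singleton whenever $\mathrm{dist}(x,\mathcal M)<R$. A known consequence is that for every $\tau\in(0,R)$, $\|\mathcal P_{\mathcal M}(x)-\mathcal P_{\mathcal M}(y)\|\le\frac{R}{R-\tau}\|x-y\|$ for all $x,y$ at distance at most $\tau$ from $\mathcal M$. Assumption on $W\in\mathbb R^{n\times n}$ (the mixing matrix of an undirected network on $n$ agents, with $W_{ij}>0$ if $(i,j)$ is an edge and, for $i\neq j$, $W_{ij}=0$ otherwise): $W$ is doubly stochastic, with $W=W^\top$; $W_{ij}\ge 0$ and $0<W_{ii}<1$ for all $i,j$; the eigenvalues of $W$ lie in $(-1,1]$; and the second largest singular value $\sigma_2$ of $W$ lies in $[0,1)$. Notation: for $x_1,\dots,x_n\in\mathcal M$, $\mathbf x=[x_1^\top,\dots,x_n^\top]^\top\in\mathbb R^{nd\times r}$ (an element of $\mathcal M^n$), $\hat x=\frac1n\sum_i x_i$, $\bar x\in\mathcal P_{\mathcal M}(\hat x)$, and $\bar{\mathbf x}=[\bar x^\top,\dots,\bar x^\top]^\top$ ($n$ copies). With iteration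 index, $\mathbf x_k=[x_{1,k}^\top,\dots,x_{n,k}^\top]^\top$, with $\bar{\mathbf x}_k$ defined accordingly. The neighborhood is $\mathcal N(\delta)=\{\mathbf x\in\mathcal M^n:\|\mathbf x-\bar{\mathbf x}\|\le\delta\}$. The consensus set is $\{\mathbf x\in\mathcal M^n:x_1=\dots=x_n\}$. *)

theory Defs
  imports "HOL-Analysis.Analysis" "HOL-Library.Multiset"
begin

section \<open>Smooth embedded submanifolds\<close>

text \<open>\<open>Ck_on k f U\<close>: all directional derivatives of \<open>f\<close> of order up to \<open>k\<close> exist and are
  continuous on \<open>U\<close>. It is only meant for open \<open>U\<close>.\<close>

primrec Ck_on ::
  "nat \<Rightarrow> ('a::euclidean_space \<Rightarrow> 'b::real_normed_vector) \<Rightarrow> 'a set \<Rightarrow> bool" where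
  "Ck_on 0 f U \<longleftrightarrow> continuous_on U f"
| "Ck_on (Suc k) f U \<longleftrightarrow>
     (\<forall>x\<in>U. f differentiable (at x)) \<and>
     (\<forall>v. Ck_on k (\<lambda>x. frechet_derivative f (at x) v) U)"

definition smooth_on :: "('a::euclidean_space \<Rightarrow> 'b::real_normed_vector) \<Rightarrow> 'a set \<Rightarrow> bool" where
  "smooth_on f U \<longleftrightarrow> (\<forall>k. Ck_on k f U)"

definition diffeomorphism ::
  "'a::euclidean_space set \<Rightarrow> 'a set \<Rightarrow> ('a \<Rightarrow> 'a) \<Rightarrow> ('a \<Rightarrow> 'a) \<Rightarrow> bool" where
  "diffeomorphism U V \<phi> \<psi> \<longleftrightarrow>
     homeomorphism U V \<phi> \<psi> \<and> smooth_on \<phi> U \<and> smooth_on \<psi> V"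

text \<open>Local slice condition: around each point some diffeomorphism of open sets of the ambient
  space straightens the set to a linear subspace of the fixed dimension \<open>m\<close>
  (no boundary points).\<close>

definition smooth_embedded_submanifold :: "'a::euclidean_space set \<Rightarrow> bool" where
  "smooth_embedded_submanifold M \<longleftrightarrow>
     (\<exists>m. \<forall>p\<in>M. \<exists>U V \<phi> \<psi> S.
        open U \<and> open V \<and> p \<in> U \<and> diffeomorphism U V \<phi> \<psi> \<and>
        subspace S \<and> dim S = m \<and> \<phi> ` (M \<inter> U) = S \<inter> V)"

section \<open>Nearest-point projection and proximal smoothness\<close>

text \<open>The projection is the set of all nearest points; \<open>y \<in> nearest_points M x\<close> says that
  \<open>y\<close> is some choice of nearest point.\<close>

definition nearest_points :: "'a::real_normed_vector set \<Rightarrow> 'a \<Rightarrow> 'a set" where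
  "nearest_points M x = {y. is_arg_min (\<lambda>y. norm (y - x)) (\<lambda>y. y \<in> M) y}"

definition proximally_smooth :: "real \<Rightarrow> 'a::real_normed_vector set \<Rightarrow> bool" where
  "proximally_smooth R M \<longleftrightarrow> (\<forall>x. infdist x M < R \<longrightarrow> is_singleton (nearest_points M x))"

section \<open>Mixing matrices\<close>

definition is_eigenvalue :: "real^'n^'n \<Rightarrow> real \<Rightarrow> bool" where
  "is_eigenvalue A l \<longleftrightarrow> (\<exists>v. v \<noteq> 0 \<and> A *v v = l *\<^sub>R v)"

text \<open>Singular values of \<open>A\<close>: the nonnegative square roots of the eigenvalues of \<open>A\<^sup>T A\<close>, each
  repeated as often as the dimension of the corresponding eigenspace.\<close>

definition singular_values :: "real^'n^'m \<Rightarrow> real multiset" where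
  "singular_values A =
     (\<Sum>s\<in>{s. 0 \<le> s \<and> is_eigenvalue (transpose A ** A) (s\<^sup>2)}.
        replicate_mset (dim {v. (transpose A ** A) *v v = s\<^sup>2 *\<^sub>R v}) s)"

text \<open>The index set of the sum above is finite, so the sum is not the default value for infinite
  sets.\<close>

lemma finite_singular_values:
  fixes A :: "real^'n^'m"
  shows "finite {s. 0 \<le> s \<and> is_eigenvalue (transpose A ** A) (s\<^sup>2)}" (is "finite ?S")
proof -
  define B where "B = transpose A ** A"
  have "\<forall>s\<in>?S. \<exists>v. v \<noteq> 0 \<and> B *v v = s\<^sup>2 *\<^sub>R v"
    by (auto simp: is_eigenvalue_def B_def)
  then obtain v where v: "\<And>s. s \<in> ?S \<Longrightarrow> v s \<noteq> 0 \<and> B *v v s = s\<^sup>2 *\<^sub>R v s"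
    by metis
  have "transpose B = B"
    by (simp add: B_def matrix_transpose_mul)
  then have sym: "(B *v a) \<bullet> b = a \<bullet> (B *v b)" for a b
    by (metis dot_lmul_matrix transpose_matrix_vector)
  have orth: "v s \<bullet> v t = 0" if "s \<in> ?S" "t \<in> ?S" "s \<noteq> t" for s t
  proof -
    have "s\<^sup>2 * (v s \<bullet> v t) = t\<^sup>2 * (v s \<bullet> v t)"
      using sym [of "v s" "v t"] v that by simp
    moreover have "s\<^sup>2 \<noteq> t\<^sup>2"
      using that by (simp add: power2_eq_iff_nonneg)
    ultimately show ?thesis by simp
  qed
  have "inj_on v ?S"
  proof (rule inj_onI)
    fix s t assume st: "s \<in> ?S" "t \<in> ?S" "v s = v t"
    then have "v s \<bullet> v t \<noteq> 0"
      using v by (metis inner_eq_zero_iff)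
    then show "s = t"
      using orth st by blast
  qed
  moreover have "pairwise orthogonal (v ` ?S)"
    unfolding pairwise_image by (intro pairwiseI) (simp only: orthogonal_def orth o_def simp_thms)
  then have "independent (v ` ?S)"
    using v by (intro pairwise_orthogonal_independent) auto
  then have "finite (v ` ?S)"
    by (rule independent_imp_finite)
  ultimately show ?thesis
    using finite_imageD by blast
qed

definition second_singular_value :: "real^'n^'m \<Rightarrow> real" where
  "second_singular_value A = rev (sorted_list_of_multiset (singular_values A)) ! 1"

definition doubly_stochastic :: "real^'n^'n \<Rightarrow> bool" where
  "doubly_stochastic W \<longleftrightarrow>
     (\<forall>i j. 0 \<le> W $ i $ j) \<and> (\<forall>i. (\<Sum>j\<in>UNIV. W $ i $ j) = 1) \<and> (\<forall>j. (\<Sum>i\<in>UNIV. W $ i $ j) = 1)"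

text \<open>\<open>E\<close> is the edge relation of the undirected network on the agents.\<close>

definition mixing_matrix :: "('n \<times> 'n) set \<Rightarrow> real^'n^'n \<Rightarrow> bool" where
  "mixing_matrix E W \<longleftrightarrow>
     sym E \<and>
     (\<forall>i j. (i, j) \<in> E \<longrightarrow> 0 < W $ i $ j) \<and>
     (\<forall>i j. i \<noteq> j \<and> (i, j) \<notin> E \<longrightarrow> W $ i $ j = 0) \<and>
     doubly_stochastic W \<and> W = transpose W \<and>
     (\<forall>i. 0 < W $ i $ i \<and> W $ i $ i < 1) \<and>
     (\<forall>l. is_eigenvalue W l \<longrightarrow> - 1 < l \<and> l \<le> 1) \<and>
     0 \<le> second_singular_value W \<and> second_singular_value W < 1"

section \<open>Stacked variables and consensus\<close>

text \<open>A stacked variable is an element of \<^typ>\<open>'a^'n\<close>; for \<open>'a = real^'r^'d\<close> its norm is the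
  Frobenius norm of the stacked matrix.\<close>

definition block_mean :: "('a::real_vector)^'n \<Rightarrow> 'a" where
  "block_mean x = (1 / real CARD('n)) *\<^sub>R (\<Sum>i\<in>UNIV. x $ i)"

definition consensus_set :: "'a set \<Rightarrow> ('a^'n) set" where
  "consensus_set M = {x. (\<forall>i. x $ i \<in> M) \<and> (\<forall>i j. x $ i = x $ j)}"

definition consensus_nbhd :: "'a::real_normed_vector set \<Rightarrow> real \<Rightarrow> ('a^'n) set" where
  "consensus_nbhd M \<delta> =
     {x. (\<forall>i. x $ i \<in> M) \<and> (\<exists>xb \<in> nearest_points M (block_mean x). norm (x - (\<chi> i. xb)) \<le> \<delta>)}"

definition converges_linearly_to_set ::
  "(nat \<Rightarrow> 'a::metric_space) \<Rightarrow> 'a set \<Rightarrow> real \<Rightarrow> bool" where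
  "converges_linearly_to_set X S \<rho> \<longleftrightarrow>
     (\<lambda>k. infdist (X k) S) \<longlonglongrightarrow> 0 \<and>
     (\<forall>k. infdist (X (Suc k)) S \<le> \<rho> * infdist (X k) S)"

end

theory Submission
  imports Defs
begin

text \<open>One step of the iteration averages and then projects. Write \<open>\<sigma>\<close> for the second singular
  value of \<open>W\<close>.

  Averaging contracts: subtracting the mean turns the stacked variable into a vector orthogonal to
  the constant ones, on which \<open>W\<close> has norm at most \<open>\<sigma>\<close> (\<open>block_norm_bound\<close>), so
  \<open>(1 - \<gamma>) I + \<gamma> W\<close> has norm at most \<open>1 - \<gamma> (1 - \<sigma>)\<close> there.

  Projecting expands little: the averaged points, as well as the mean, stay within \<open>\<delta>\<close> of the
  projected mean, hence of \<open>M\<close>, and within that distance the projection is Lipschitz with constant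
  \<open>R / (R - \<delta>)\<close> (\<open>nearest_points_Lipschitz\<close>). The product of the two constants is \<open>\<rho>1\<close>.

  The Lipschitz estimate compares the new variables with the old projected mean, while the claim is
  about the new one. But the sum of squared distances from the agents to a point \<open>z\<close> is a constant
  plus a multiple of the squared distance from the mean to \<open>z\<close>, so among the points of \<open>M\<close> the
  projected mean minimizes it, and replacing the old projected mean by the new one only helps. The
  same identity shows that the distance to the consensus set is the distance to the stacked projected
  mean, and as \<open>\<rho>1 < 1\<close> the neighbourhood is never left.

  The Lipschitz property is the delicate part, because proximal smoothness only asserts uniqueness
  of nearest points. Following Federer's theory of sets of positive reach, a nearest point is shown
  to remain nearest along the whole normal ray up to distance \<open>R\<close>; that every such ball of radius
  below \<open>R\<close> has no point of \<open>M\<close> in its interior gives a quadratic bound on how far \<open>M\<close> can bend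
  towards the normal (\<open>nearest_point_normal_inequality\<close>), and adding this bound at two points gives
  the Lipschitz estimate.\<close>

section \<open>Projection onto a proximally smooth set\<close>

lemma nearest_points_iff:
  "y \<in> nearest_points M x \<longleftrightarrow> y \<in> M \<and> (\<forall>z\<in>M. norm (y - x) \<le> norm (z - x))"
  by (auto simp: nearest_points_def is_arg_min_def not_less)

lemma nearest_points_infdist:
  assumes "y \<in> nearest_points M x"
  shows "infdist x M = norm (y - x)"
proof (rule antisym)
  show "infdist x M \<le> norm (y - x)"
    using assms infdist_le[of y M x] by (simp add: nearest_points_iff dist_norm norm_minus_commute)
  have "M \<noteq> {}" using assms by (auto simp: nearest_points_iff)
  then show "norm (y - x) \<le> infdist x M"
    using assms unfolding infdist_notempty[OF \<open>M \<noteq> {}\<close>]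
    by (intro cINF_greatest) (auto simp: nearest_points_iff dist_norm norm_minus_commute)
qed

lemma proximally_smooth_unique:
  assumes "proximally_smooth R M" "infdist x M < R"
    and "y \<in> nearest_points M x" "z \<in> nearest_points M x"
  shows "y = z"
  using assms unfolding proximally_smooth_def is_singleton_def by (metis singletonD)

lemma nearest_points_segment:
  assumes "y \<in> nearest_points M x" "0 \<le> s" "s \<le> 1"
  shows "y \<in> nearest_points M (y + s *\<^sub>R (x - y))"
  unfolding nearest_points_iff
proof (intro conjI ballI)
  show "y \<in> M" using assms by (simp add: nearest_points_iff)
  fix z assume "z \<in> M"
  let ?w = "y + s *\<^sub>R (x - y)"
  have "norm (y - x) \<le> norm (z - x)" using assms \<open>z \<in> M\<close> by (simp add: nearest_points_iff)
  also have "\<dots> \<le> norm (z - ?w) + norm (?w - x)"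
    using norm_triangle_ineq[of "z - ?w" "?w - x"] by simp
  also have "?w - x = (1 - s) *\<^sub>R (y - x)" by (simp add: algebra_simps)
  also have "norm \<dots> = norm (y - x) - s * norm (y - x)" using assms by (simp add: left_diff_distrib)
  finally have "s * norm (y - x) \<le> norm (z - ?w)" by simp
  moreover have "norm (y - ?w) = s * norm (y - x)" using assms by (simp add: norm_minus_commute)
  ultimately show "norm (y - ?w) \<le> norm (z - ?w)" by simp
qed

lemma continuous_on_projection:
  fixes M :: "'a::euclidean_space set"
  assumes "compact M" and p: "\<And>x. x \<in> S \<Longrightarrow> nearest_points M x = {p x}" and "closed S"
  shows "continuous_on S p"
proof (rule continuous_from_closed_graph)
  have *: "p x \<in> M" if "x \<in> S" for x using p[OF that] nearest_points_iff by blast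
  show "compact M" by fact
  show "p \<in> S \<rightarrow> M" using * by blast
  let ?G = "(\<Inter>z\<in>M. {q :: 'a \<times> 'a. norm (snd q - fst q) \<le> norm (z - fst q)}) \<inter> (S \<times> M)"
  have "(\<lambda>x. (x, p x)) ` S = ?G"
  proof
    show "(\<lambda>x. (x, p x)) ` S \<subseteq> ?G"
    proof (rule image_subsetI)
      fix x assume x: "x \<in> S"
      then have "p x \<in> nearest_points M x" using p by blast
      then show "(x, p x) \<in> ?G" using x by (auto simp: nearest_points_iff)
    qed
    show "?G \<subseteq> (\<lambda>x. (x, p x)) ` S"
    proof
      fix q assume q: "q \<in> ?G"
      then have "snd q \<in> nearest_points M (fst q)" "fst q \<in> S" by (auto simp: nearest_points_iff)
      then have "snd q = p (fst q)" using p by blast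
      then have "q = (fst q, p (fst q))" by (simp add: prod_eq_iff)
      then show "q \<in> (\<lambda>x. (x, p x)) ` S" using \<open>fst q \<in> S\<close> by (rule image_eqI)
    qed
  qed
  moreover have "closed ?G"
    by (intro closed_Int closed_INT ballI closed_Collect_le closed_Times assms compact_imp_closed
        continuous_intros)
  ultimately show "closed ((\<lambda>x. (x, p x)) ` S)" by simp
qed

text \<open>A nearest point \<open>y\<close> stays nearest a little beyond \<open>x = y + t u\<close>. Rather than moving away from
  \<open>x\<close> along \<open>u\<close>, look for a point \<open>z\<close> at distance \<open>e\<close> from \<open>x\<close> whose own projection sees \<open>x\<close> on the
  segment towards \<open>z\<close>: such a \<open>z\<close> is a fixed point of the map that sends \<open>z\<close> to the point at distance
  \<open>e\<close> beyond \<open>x\<close> in the direction from the projection of \<open>z\<close> to \<open>x\<close>, so Brouwer's theorem provides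
  one. Since nearest points persist towards the set, the projection of \<open>z\<close> is also nearest to \<open>x\<close>;
  uniqueness makes it \<open>y\<close>, which forces \<open>z = y + (t + e) u\<close>.\<close>

lemma nearest_point_prolong:
  fixes M :: "'a::euclidean_space set"
  assumes "compact M" "proximally_smooth R M" 
    and y: "y \<in> nearest_points M (y + t *\<^sub>R u)" and u: "norm u = 1" and t: "0 < t" "t < R"
  shows "\<exists>\<epsilon>>0. \<forall>e. 0 \<le> e \<and> e \<le> \<epsilon> \<longrightarrow> y \<in> nearest_points M (y + (t + e) *\<^sub>R u)"
proof -
  define x where "x = y + t *\<^sub>R u"
  \<comment> \<open>any \<open>e\<close> that keeps the ball around \<open>x\<close> inside the region of unique projection\<close>
  define e where "e = (R - t) / 2"
  have e: "e > 0" "t + e < R" using t by (auto simp: e_def field_simps)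
  have ix: "infdist x M = t" using nearest_points_infdist[OF y] u t by (simp add: x_def)
  have near: "infdist z M < R" if "z \<in> cball x e" for z
  proof -
    have "infdist z M \<le> infdist x M + dist z x" by (rule infdist_triangle)
    then show ?thesis using that ix e by (auto simp: dist_commute)
  qed
  define p where "p z = (THE q. q \<in> nearest_points M z)" for z
  have p: "nearest_points M z = {p z}" if "z \<in> cball x e" for z
    using near[OF that] assms(2) unfolding proximally_smooth_def p_def is_singleton_def
    by (metis singleton_iff the_equality)
  have pM: "t \<le> norm (x - p z)" if "z \<in> cball x e" for z
  proof -
    have "p z \<in> M" using p[OF that] nearest_points_iff by blast
    then show ?thesis using infdist_le[of "p z" M x] ix by (simp add: dist_norm)
  qed
  define F where "F z = x + (e / norm (x - p z)) *\<^sub>R (x - p z)" for z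
  have cp: "continuous_on (cball x e) p"
    by (rule continuous_on_projection[OF assms(1) p]) auto
  have cF: "continuous_on (cball x e) F"
    unfolding F_def using pM t by (intro continuous_intros cp) force
  have "F \<in> cball x e \<rightarrow> cball x e"
    using pM t e by (auto simp: F_def dist_norm)
  with brouwer_ball[OF e(1) cF] obtain z where z: "z \<in> cball x e" "F z = z" by blast
  define r where "r = norm (x - p z)"
  have r: "r \<ge> t" "r > 0" using pM[OF z(1)] t by (auto simp: r_def)
  have zx: "z - x = (e / r) *\<^sub>R (x - p z)" using z(2) by (simp add: F_def r_def algebra_simps)
  have "z - p z = (z - x) + (x - p z)" by simp
  also have "\<dots> = (e / r + 1) *\<^sub>R (x - p z)" using zx by (simp add: algebra_simps)
  finally have "(r / (r + e)) *\<^sub>R (z - p z) = (r / (r + e) * (e / r + 1)) *\<^sub>R (x - p z)" by simp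
  also have "r / (r + e) * (e / r + 1) = 1"
    using r e by (simp add: divide_simps)
  finally have "x = p z + (r / (r + e)) *\<^sub>R (z - p z)" by simp
  moreover have "p z \<in> nearest_points M z" using p z by blast
  ultimately have "p z \<in> nearest_points M x"
    using nearest_points_segment[of "p z" M z "r / (r + e)"] r e by simp
  then have py: "p z = y"
    using proximally_smooth_unique[OF assms(2)] ix t y unfolding x_def[symmetric] by blast
  have "r = t" using u t by (simp add: r_def py x_def)
  have zu: "z - y = (t + e) *\<^sub>R u"
  proof -
    have "z - y = (z - x) + (x - y)" by simp
    also have "\<dots> = (e / t) *\<^sub>R (t *\<^sub>R u) + t *\<^sub>R u"
      using zx unfolding py \<open>r = t\<close> by (simp add: x_def)
    finally show ?thesis using t by (simp add: algebra_simps)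
  qed
  show ?thesis
  proof (intro exI[of _ e] conjI allI impI)
    fix a assume a: "0 \<le> a \<and> a \<le> e"
    have "y \<in> nearest_points M (y + ((t + a) / (t + e)) *\<^sub>R (z - y))"
      using \<open>p z \<in> nearest_points M z\<close> a t e unfolding py by (intro nearest_points_segment) auto
    then show "y \<in> nearest_points M (y + (t + a) *\<^sub>R u)" using zu t e by simp
  qed (rule e)
qed

text \<open>The parameters at which \<open>y\<close> is nearest form a closed set, and by \<open>nearest_point_prolong\<close> its
  maximum cannot lie below \<open>b\<close>.\<close>

lemma nearest_point_on_normal_ray:
  fixes M :: "'a::euclidean_space set"
  assumes "compact M" "proximally_smooth R M"
    and y: "y \<in> nearest_points M (y + d *\<^sub>R u)" and u: "norm u = 1" and d: "0 < d"
    and b: "d \<le> b" "b < R"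
  shows "y \<in> nearest_points M (y + b *\<^sub>R u)"
proof -
  let ?T = "(\<Inter>z\<in>M. {t. norm (y - (y + t *\<^sub>R u)) \<le> norm (z - (y + t *\<^sub>R u))}) \<inter> {d..b}"
  have yM: "y \<in> M" using y by (simp add: nearest_points_iff)
  have T: "t \<in> ?T \<longleftrightarrow> t \<in> {d..b} \<and> y \<in> nearest_points M (y + t *\<^sub>R u)" for t
    using yM by (auto simp: nearest_points_iff)
  have "compact ?T"
    by (intro closed_Int_compact closed_INT ballI closed_Collect_le continuous_intros compact_Icc)
  moreover have "d \<in> ?T" unfolding T using y b by simp
  ultimately obtain s where s: "s \<in> ?T" "\<And>t. t \<in> ?T \<Longrightarrow> t \<le> s"
    using compact_attains_sup[of ?T] by blast
  have "s = b"
  proof (rule ccontr)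
    assume "s \<noteq> b"
    then have "s < b" "0 < s" using s d by auto
    moreover have ys: "y \<in> nearest_points M (y + s *\<^sub>R u)" using s(1) T by blast
    ultimately obtain \<epsilon> where \<epsilon>: "\<epsilon> > 0"
      "\<And>e. 0 \<le> e \<and> e \<le> \<epsilon> \<Longrightarrow> y \<in> nearest_points M (y + (s + e) *\<^sub>R u)"
      using nearest_point_prolong[OF assms(1,2) ys u] b by auto
    let ?e = "min \<epsilon> (b - s)"
    have "?e > 0" using \<epsilon> \<open>s < b\<close> by simp
    moreover have "s + ?e \<in> ?T"
      unfolding T using \<epsilon>(2)[of ?e] \<open>?e > 0\<close> s(1) by (auto simp: min_def)
    ultimately show False using s(2) by fastforce
  qed
  then show ?thesis using s(1) T by blast
qed

text \<open>For \<open>b < R\<close> the ball of radius \<open>b\<close> around \<open>y + b u\<close> has no point of \<open>M\<close> in its interior;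
  expanding the square gives \<open>2 b (u \<bullet> (z - y)) \<le> (norm (z - y))\<^sup>2\<close>, and \<open>b\<close> tends to \<open>R\<close>. The limit
  is taken because the prolongation along the ray rests on uniqueness, which may fail at distance \<open>R\<close>.\<close>

lemma nearest_point_normal_inequality:
  fixes M :: "'a::euclidean_space set"
  assumes "compact M" "proximally_smooth R M"
    and y: "y \<in> nearest_points M x" and d: "norm (x - y) < R" and z: "z \<in> M"
  shows "(x - y) \<bullet> (z - y) \<le> norm (x - y) / (2 * R) * (norm (z - y))\<^sup>2"
proof (cases "x = y")
  case False
  define d where "d = norm (x - y)"
  define u where "u = (1 / d) *\<^sub>R (x - y)"
  have d0: "0 < d" "d < R" using False d by (auto simp: d_def)
  have u: "norm u = 1" using d0 by (simp add: u_def d_def)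
  have xy: "x - y = d *\<^sub>R u" using d0 by (simp add: u_def)
  have yd: "y \<in> nearest_points M (y + d *\<^sub>R u)" using y xy by (metis add.commute diff_add_cancel)
  have *: "2 * b * (u \<bullet> (z - y)) \<le> (norm (z - y))\<^sup>2" if "d < b" "b < R" for b
  proof -
    have "y \<in> nearest_points M (y + b *\<^sub>R u)"
      using nearest_point_on_normal_ray[OF assms(1,2) yd u] d0 that by simp
    then have "norm (b *\<^sub>R u) \<le> norm ((z - y) - b *\<^sub>R u)"
      using z by (simp add: nearest_points_iff algebra_simps)
    then have "(norm (b *\<^sub>R u))\<^sup>2 \<le> (norm ((z - y) - b *\<^sub>R u))\<^sup>2"
      by (simp add: power_mono)
    then show ?thesis
      by (simp add: power2_norm_eq_inner inner_diff_left inner_diff_right inner_commute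
          del: norm_scaleR)
  qed
  have "2 * R * (u \<bullet> (z - y)) \<le> (norm (z - y))\<^sup>2"
  proof (rule tendsto_le[OF _ tendsto_const])
    show "((\<lambda>b. 2 * b * (u \<bullet> (z - y))) \<longlongrightarrow> 2 * R * (u \<bullet> (z - y))) (at_left R)"
      by (intro tendsto_intros)
    show "\<forall>\<^sub>F b in at_left R. 2 * b * (u \<bullet> (z - y)) \<le> (norm (z - y))\<^sup>2"
      using * d0 by (intro eventually_at_leftI[of d]) auto
  qed simp
  then have "d * (2 * R * (u \<bullet> (z - y))) \<le> d * (norm (z - y))\<^sup>2"
    using d0 by (intro mult_left_mono) auto
  then show ?thesis using d0 unfolding d_def[symmetric] xy by (simp add: u field_simps)
qed simp

lemma nearest_points_Lipschitz:
  fixes M :: "'a::euclidean_space set"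
  assumes "compact M" "proximally_smooth R M" and \<tau>: "\<tau> < R"
    and x: "infdist x M \<le> \<tau>" "p \<in> nearest_points M x"
    and y: "infdist y M \<le> \<tau>" "q \<in> nearest_points M y"
  shows "norm (p - q) \<le> R / (R - \<tau>) * norm (x - y)"
proof -
  have R: "0 < R" using \<tau> x(1) infdist_nonneg[of x M] by linarith
  have dx: "norm (x - p) \<le> \<tau>" "norm (y - q) \<le> \<tau>"
    using x y nearest_points_infdist by (metis norm_minus_commute)+
  have pq: "p \<in> M" "q \<in> M" using x y by (auto simp: nearest_points_iff)
  have "(x - p) \<bullet> (q - p) \<le> norm (x - p) / (2 * R) * (norm (q - p))\<^sup>2"
    using nearest_point_normal_inequality[OF assms(1,2) x(2)] dx pq \<tau> by simp
  also have "\<dots> \<le> \<tau> / (2 * R) * (norm (q - p))\<^sup>2"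
    using dx R by (intro mult_right_mono divide_right_mono) auto
  finally have 1: "(x - p) \<bullet> (q - p) \<le> \<tau> / (2 * R) * (norm (p - q))\<^sup>2"
    by (simp add: norm_minus_commute)
  have "(y - q) \<bullet> (p - q) \<le> norm (y - q) / (2 * R) * (norm (p - q))\<^sup>2"
    using nearest_point_normal_inequality[OF assms(1,2) y(2)] dx pq \<tau> by simp
  also have "\<dots> \<le> \<tau> / (2 * R) * (norm (p - q))\<^sup>2"
    using dx R by (intro mult_right_mono divide_right_mono) auto
  finally have 2: "(y - q) \<bullet> (p - q) \<le> \<tau> / (2 * R) * (norm (p - q))\<^sup>2" .
  have "(norm (p - q))\<^sup>2 = (x - p) \<bullet> (q - p) + (y - q) \<bullet> (p - q) + (x - y) \<bullet> (p - q)"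
    by (simp add: power2_norm_eq_inner inner_diff_left inner_diff_right inner_commute)
  also have "\<dots> \<le> \<tau> / (2 * R) * (norm (p - q))\<^sup>2 + \<tau> / (2 * R) * (norm (p - q))\<^sup>2
      + norm (x - y) * norm (p - q)"
    using 1 2 norm_cauchy_schwarz by (intro add_mono)
  also have "\<dots> = \<tau> / R * (norm (p - q))\<^sup>2 + norm (x - y) * norm (p - q)" by simp
  finally have "norm (p - q) * ((1 - \<tau> / R) * norm (p - q)) \<le> norm (p - q) * norm (x - y)"
    by (simp add: algebra_simps power2_eq_square)
  then have "(1 - \<tau> / R) * norm (p - q) \<le> norm (x - y)"
    by (cases "p = q") auto
  then show ?thesis using R \<tau> by (simp add: field_simps)
qed

section \<open>The second singular value of a doubly stochastic symmetric matrix\<close>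

text \<open>In the sorted list only the last entry can exceed the last but one, so \<open>a\<close> and \<open>b\<close> cannot
  both do so.\<close>

lemma sorted_list_of_multiset_second_ge:
  fixes S :: "real multiset"
  assumes "{#a, b#} \<subseteq># S"
  shows "min a b \<le> rev (sorted_list_of_multiset S) ! 1"
proof -
  let ?xs = "sorted_list_of_multiset S" and ?n = "size S"
  have len: "length ?xs = ?n" by (metis mset_sorted_list_of_multiset size_mset)
  have n: "2 \<le> ?n" using size_mset_mono[OF assms] by simp
  have r: "rev ?xs ! 1 = ?xs ! (?n - 2)" using n len by (simp add: rev_nth numeral_2_eq_2)
  show ?thesis
  proof (rule ccontr)
    assume "\<not> ?thesis"
    then have small: "?xs ! (?n - 2) < a" "?xs ! (?n - 2) < b" using r by auto
    have "filter_mset (\<lambda>c. ?xs ! (?n - 2) < c) {#a, b#} \<subseteq># filter_mset (\<lambda>c. ?xs ! (?n - 2) < c) S"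
      using assms by (rule multiset_filter_mono)
    then have "2 \<le> size (filter_mset (\<lambda>c. ?xs ! (?n - 2) < c) S)"
      using small size_mset_mono by fastforce
    also have "\<dots> = length (filter (\<lambda>c. ?xs ! (?n - 2) < c) ?xs)"
      by (metis mset_filter mset_sorted_list_of_multiset size_mset)
    also have "\<dots> = card {i. i < length ?xs \<and> ?xs ! (?n - 2) < ?xs ! i}"
      by (rule length_filter_conv_card)
    also have "\<dots> \<le> card {?n - 1}"
    proof (rule card_mono)
      show "{i. i < length ?xs \<and> ?xs ! (?n - 2) < ?xs ! i} \<subseteq> {?n - 1}"
      proof
        fix i assume "i \<in> {i. i < length ?xs \<and> ?xs ! (?n - 2) < ?xs ! i}"
        then have i: "i < ?n" "?xs ! (?n - 2) < ?xs ! i" using len by auto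
        have "\<not> i \<le> ?n - 2"
        proof
          assume "i \<le> ?n - 2"
          then have "?xs ! i \<le> ?xs ! (?n - 2)"
            using len n by (intro sorted_nth_mono) auto
          then show False using i by simp
        qed
        then show "i \<in> {?n - 1}" using i by auto
      qed
    qed simp
    finally show False by simp
  qed
qed

text \<open>Two orthogonal eigenvectors contribute two members to the multiset of singular values, even when
  \<open>a = b\<close>, because then the eigenspace has dimension at least two.\<close>

lemma min_le_second_singular_value:
  fixes A :: "real^'n^'m"
  assumes "0 \<le> a" "0 \<le> b" "v \<noteq> 0" "w \<noteq> 0" "v \<bullet> w = 0"
    and v: "(transpose A ** A) *v v = a\<^sup>2 *\<^sub>R v" and w: "(transpose A ** A) *v w = b\<^sup>2 *\<^sub>R w"
  shows "min a b \<le> second_singular_value A"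
proof -
  let ?B = "transpose A ** A"
  let ?E = "\<lambda>s::real. {v. ?B *v v = s\<^sup>2 *\<^sub>R v}"
  let ?I = "{s. 0 \<le> s \<and> is_eigenvalue ?B (s\<^sup>2)}"
  have "a \<in> ?I" "b \<in> ?I" using assms by (auto simp: is_eigenvalue_def)
  have cnt: "count (singular_values A) s = dim (?E s)" if "s \<in> ?I" for s
    unfolding singular_values_def count_sum
    using that finite_singular_values[of A] by (subst sum.remove[of _ s]) auto
  have dim1: "1 \<le> dim (?E s)" if "x \<noteq> 0" "x \<in> ?E s" for x s
  proof -
    have "independent {x}" using that(1) by simp
    then show ?thesis using independent_card_le_dim[of "{x}" "?E s"] that by simp
  qed
  have "{#a, b#} \<subseteq># singular_values A"
  proof (cases "a = b")
    case True
    have "v \<noteq> w" using assms by auto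
    have "independent {v, w}"
      using assms by (intro pairwise_orthogonal_independent)
        (auto simp: pairwise_def orthogonal_def inner_commute)
    moreover have "{v, w} \<subseteq> ?E a" using v w True by auto
    ultimately have "2 \<le> dim (?E a)"
      using independent_card_le_dim[of "{v, w}" "?E a"] \<open>v \<noteq> w\<close> by simp
    then show ?thesis using cnt[OF \<open>a \<in> ?I\<close>] True by (auto simp: subseteq_mset_def)
  next
    case False
    have "1 \<le> count (singular_values A) a" "1 \<le> count (singular_values A) b"
      using cnt \<open>a \<in> ?I\<close> \<open>b \<in> ?I\<close> dim1[of v a] dim1[of w b] assms by auto
    then show ?thesis using False by (auto simp: subseteq_mset_def)
  qed
  then show ?thesis
    unfolding second_singular_value_def by (rule sorted_list_of_multiset_second_ge)
qed

text \<open>A substitute for the spectral theorem: a unit vector of \<open>S\<close> at which \<open>norm (A *v v)\<close> is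
  maximal is an eigenvector. The defect \<open>g\<close> of the eigenvalue equation lies in \<open>S\<close> and is the
  direction of steepest ascent of the Rayleigh quotient, so a step along \<open>g\<close> would increase it
  unless \<open>g = 0\<close>.\<close>

lemma Rayleigh_maximizer:
  fixes A :: "real^'n^'m"
  assumes S: "subspace S" "S \<noteq> {0}"
    and inv: "\<And>v. v \<in> S \<Longrightarrow> (transpose A ** A) *v v \<in> S"
  obtains s v where "0 \<le> s" "v \<in> S" "v \<noteq> 0" "(transpose A ** A) *v v = s\<^sup>2 *\<^sub>R v"
    "\<And>w. w \<in> S \<Longrightarrow> norm (A *v w) \<le> s * norm w"
proof -
  let ?K = "sphere 0 1 \<inter> S"
  obtain x where x: "x \<in> S" "x \<noteq> 0" using S subspace_0 by blast
  have "(1 / norm x) *\<^sub>R x \<in> ?K" using x S by (simp add: subspace_scale)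
  moreover have "compact ?K" using S by (simp add: closed_subspace compact_Int_closed)
  moreover have "continuous_on ?K (\<lambda>v. norm (A *v v))"
    by (intro continuous_intros matrix_vector_mult_linear_continuous_on)
  ultimately obtain v where v: "v \<in> ?K" and max: "\<And>w. w \<in> ?K \<Longrightarrow> norm (A *v w) \<le> norm (A *v v)"
    using continuous_attains_sup[of ?K "\<lambda>v. norm (A *v v)"] by blast
  define s where "s = norm (A *v v)"
  have bound: "norm (A *v w) \<le> s * norm w" if "w \<in> S" for w
  proof (cases "w = 0")
    case False
    have "(1 / norm w) *\<^sub>R w \<in> ?K" using that False S by (simp add: subspace_scale)
    then have "norm (A *v ((1 / norm w) *\<^sub>R w)) \<le> s" using max s_def by blast
    then show ?thesis using False by (simp add: matrix_vector_mult_scaleR field_simps)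
  qed simp
  have AA: "(A *v a) \<bullet> (A *v b) = ((transpose A ** A) *v a) \<bullet> b" for a b
    by (metis dot_lmul_matrix inner_commute matrix_vector_mul_assoc transpose_matrix_vector)
  define g where "g = (transpose A ** A) *v v - s\<^sup>2 *\<^sub>R v"
  have eq: "(transpose A ** A) *v v = g + s\<^sup>2 *\<^sub>R v" by (simp add: g_def)
  have gS: "g \<in> S" unfolding g_def using v inv S by (simp add: subspace_diff subspace_scale)
  define c where "c = s\<^sup>2 * (g \<bullet> g) - (A *v g) \<bullet> (A *v g)"
  have key: "2 * t * (g \<bullet> g) \<le> t\<^sup>2 * c" for t
  proof -
    have "v + t *\<^sub>R g \<in> S" using v gS S by (simp add: subspace_add subspace_scale)
    then have "(norm (A *v (v + t *\<^sub>R g)))\<^sup>2 \<le> (s * norm (v + t *\<^sub>R g))\<^sup>2"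
      by (intro power_mono bound) auto
    moreover have "(norm (A *v (v + t *\<^sub>R g)))\<^sup>2
        = s\<^sup>2 + 2 * t * ((A *v v) \<bullet> (A *v g)) + t\<^sup>2 * ((A *v g) \<bullet> (A *v g))"
      unfolding power2_norm_eq_inner s_def
      by (simp add: matrix_vector_right_distrib matrix_vector_mult_scaleR inner_add_left
          inner_add_right inner_commute power2_eq_square algebra_simps)
    moreover have "v \<bullet> v = 1" using v by (simp add: norm_eq_1)
    then have "(s * norm (v + t *\<^sub>R g))\<^sup>2 = s\<^sup>2 * (1 + 2 * t * (v \<bullet> g) + t\<^sup>2 * (g \<bullet> g))"
      unfolding power_mult_distrib power2_norm_eq_inner
      by (simp add: inner_add_left inner_add_right inner_commute power2_eq_square algebra_simps)
    moreover have "(A *v v) \<bullet> (A *v g) = g \<bullet> g + s\<^sup>2 * (v \<bullet> g)"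
      using eq unfolding AA by (simp add: inner_add_left)
    ultimately show ?thesis by (simp add: c_def algebra_simps)
  qed
  have "g \<bullet> g \<le> 0"
  proof (rule ccontr)
    assume "\<not> g \<bullet> g \<le> 0"
    then have G: "g \<bullet> g > 0" by (rule not_le_imp_less)
    have "2 * (g \<bullet> g) \<le> c" using key[of 1] by simp
    then have "c > 0" using G by linarith
    \<comment> \<open>the step length for which the quadratic term is half of the linear one\<close>
    have "2 * (g \<bullet> g / c) * (g \<bullet> g) \<le> (g \<bullet> g / c)\<^sup>2 * c" by (rule key)
    also have "\<dots> = (g \<bullet> g / c) * (g \<bullet> g)" using \<open>c > 0\<close> by (simp add: power2_eq_square)
    finally have "(g \<bullet> g / c) * (g \<bullet> g) \<le> 0" by linarith
    moreover have "(g \<bullet> g / c) * (g \<bullet> g) > 0"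
      using G \<open>c > 0\<close> by (intro mult_pos_pos divide_pos_pos)
    ultimately show False by linarith
  qed
  then have "g = 0" by (metis inner_eq_zero_iff inner_ge_zero antisym)
  then have "(transpose A ** A) *v v = s\<^sup>2 *\<^sub>R v" by (simp add: g_def)
  moreover have "v \<in> S" "v \<noteq> 0" "0 \<le> s" using v by (auto simp: s_def)
  ultimately show ?thesis using that bound by blast
qed

text \<open>The operator norm \<open>s\<close> of \<open>W\<close> on the orthogonal complement of the constant vector is a singular
  value with an eigenvector orthogonal to that of the singular value 1. Hence the second singular
  value is at least \<open>min 1 s\<close>, and as it is below 1 it is at least \<open>s\<close>.\<close>

lemma mixing_matrix_norm_bound:
  fixes W :: "real^'n^'n"
  assumes W: "mixing_matrix E W" and v: "(\<Sum>i\<in>UNIV. v $ i) = 0"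
  shows "norm (W *v v) \<le> second_singular_value W * norm v"
proof (cases "v = 0")
  case False
  let ?one = "\<chi> i. 1 :: real^'n"
  let ?S = "{v. orthogonal ?one v}"
  have row: "(\<Sum>j\<in>UNIV. W $ i $ j) = 1" for i
    using W by (simp add: mixing_matrix_def doubly_stochastic_def)
  have tr: "transpose W = W" and \<sigma>: "second_singular_value W < 1"
    using W by (auto simp: mixing_matrix_def)
  have one: "W *v ?one = ?one"
    using row by (simp add: vec_eq_iff matrix_vector_mult_def)
  have orth: "w \<in> ?S \<longleftrightarrow> (\<Sum>i\<in>UNIV. w $ i) = 0" for w
    by (simp add: orthogonal_def inner_vec_def)
  have WS: "W *v w \<in> ?S" if "w \<in> ?S" for w
  proof -
    have "?one \<bullet> (W *v w) = (W *v ?one) \<bullet> w"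
      by (metis dot_lmul_matrix tr transpose_matrix_vector)
    then show ?thesis using that one by (simp add: orthogonal_def)
  qed
  have "subspace ?S" by (rule subspace_orthogonal_to_vector)
  moreover have "v \<in> ?S" using v orth by blast
  then have "?S \<noteq> {0}" using False by blast
  moreover have "(transpose W ** W) *v w \<in> ?S" if "w \<in> ?S" for w
    using WS[OF WS[OF that]] by (simp add: tr matrix_vector_mul_assoc)
  ultimately obtain s w where s: "0 \<le> s" "w \<in> ?S" "w \<noteq> 0"
      "(transpose W ** W) *v w = s\<^sup>2 *\<^sub>R w" "\<And>w. w \<in> ?S \<Longrightarrow> norm (W *v w) \<le> s * norm w"
    using Rayleigh_maximizer[of ?S W] by blast
  have "?one \<noteq> 0" by (simp add: vec_eq_iff)
  moreover have "(transpose W ** W) *v ?one = 1\<^sup>2 *\<^sub>R ?one"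
    by (simp add: tr one flip: matrix_vector_mul_assoc)
  ultimately have "min 1 s \<le> second_singular_value W"
    using s by (intro min_le_second_singular_value[of 1 s ?one w]) (auto simp: orthogonal_def)
  then have "s \<le> second_singular_value W" using \<sigma> by auto
  then have "s * norm v \<le> second_singular_value W * norm v" by (intro mult_right_mono) auto
  then show ?thesis using s(5)[OF \<open>v \<in> ?S\<close>] by linarith
qed simp

section \<open>Stacked variables\<close>

lemma norm_vec_power2: "(norm x)\<^sup>2 = (\<Sum>i\<in>UNIV. (norm (x $ i))\<^sup>2)"
  for x :: "('a::real_normed_vector)^'n"
  by (simp add: norm_vec_def L2_set_def sum_nonneg)

lemma norm_vec_mono:
  fixes x :: "('a::real_normed_vector)^'n" and y :: "('b::real_normed_vector)^'n"
  assumes "\<And>i. norm (x $ i) \<le> c * norm (y $ i)" "0 \<le> c"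
  shows "norm x \<le> c * norm y"
proof -
  have "norm x \<le> L2_set (\<lambda>i. c * norm (y $ i)) UNIV"
    unfolding norm_vec_def using assms by (intro L2_set_mono) auto
  also have "\<dots> = c * norm y"
    unfolding norm_vec_def using assms by (simp add: L2_set_right_distrib)
  finally show ?thesis .
qed

text \<open>The scalar bound applies to the vector of \<open>b\<close>-coordinates for each basis vector \<open>b\<close>; squared
  norms add up over the basis.\<close>

lemma block_norm_bound:
  fixes e :: "('a::euclidean_space)^'n"
  assumes W: "mixing_matrix E W" and e: "(\<Sum>i\<in>UNIV. e $ i) = 0"
  shows "norm (\<chi> i. \<Sum>j\<in>UNIV. W $ i $ j *\<^sub>R e $ j) \<le> second_singular_value W * norm e"
proof -
  let ?\<sigma> = "second_singular_value W"
  have \<sigma>: "0 \<le> ?\<sigma>" using W by (simp add: mixing_matrix_def)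
  define c where "c b = (\<chi> i. e $ i \<bullet> b)" for b
  have parseval: "(norm y)\<^sup>2 = (\<Sum>b\<in>Basis. (norm (\<chi> i. y $ i \<bullet> b))\<^sup>2)" for y :: "'a^'n"
  proof -
    have "(norm y)\<^sup>2 = (\<Sum>i\<in>UNIV. \<Sum>b\<in>Basis. (y $ i \<bullet> b)\<^sup>2)"
      unfolding norm_vec_power2
      by (simp add: power2_norm_eq_inner[of "y $ i" for i] power2_eq_square[of "y $ i \<bullet> b" for i b]
          flip: euclidean_inner)
    also have "\<dots> = (\<Sum>b\<in>Basis. \<Sum>i\<in>UNIV. (y $ i \<bullet> b)\<^sup>2)" by (rule sum.swap)
    finally show ?thesis by (simp add: norm_vec_power2)
  qed
  have coord: "(\<chi> i. (\<Sum>j\<in>UNIV. W $ i $ j *\<^sub>R e $ j) \<bullet> b) = W *v c b" for b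
    by (simp add: vec_eq_iff matrix_vector_mult_def inner_sum_left c_def)
  have "(\<Sum>i\<in>UNIV. c b $ i) = 0" for b
    using e by (simp add: c_def flip: inner_sum_left)
  then have "(norm (W *v c b))\<^sup>2 \<le> (?\<sigma> * norm (c b))\<^sup>2" for b
    using mixing_matrix_norm_bound[OF W] by (intro power_mono) auto
  then have "(\<Sum>b\<in>Basis. (norm (W *v c b))\<^sup>2) \<le> (\<Sum>b\<in>Basis. (?\<sigma> * norm (c b))\<^sup>2)"
    by (intro sum_mono) auto
  then have "(norm (\<chi> i. \<Sum>j\<in>UNIV. W $ i $ j *\<^sub>R e $ j))\<^sup>2 \<le> (?\<sigma> * norm e)\<^sup>2"
    unfolding parseval[of "\<chi> i. \<Sum>j\<in>UNIV. W $ i $ j *\<^sub>R e $ j"] power_mult_distrib parseval[of e]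
    by (simp add: coord power_mult_distrib sum_distrib_left c_def)
  then show ?thesis using \<sigma> by (simp add: power2_le_iff_abs_le)
qed

text \<open>The parallel axis identity: the deviations from the mean sum to zero, which removes the cross
  term.\<close>

lemma norm_diff_stack_power2:
  fixes x :: "('a::real_inner)^'n"
  shows "(norm (x - (\<chi> i. z)))\<^sup>2
    = (norm (x - (\<chi> i. block_mean x)))\<^sup>2 + real CARD('n) * (norm (block_mean x - z))\<^sup>2"
proof -
  let ?m = "block_mean x"
  have m: "(\<Sum>i\<in>UNIV. x $ i - ?m) = 0"
    by (simp add: sum_subtractf block_mean_def sum_constant_scaleR)
  have "(norm (x $ i - z))\<^sup>2
      = (norm (x $ i - ?m))\<^sup>2 + 2 * ((x $ i - ?m) \<bullet> (?m - z)) + (norm (?m - z))\<^sup>2" for i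
    by (simp add: power2_norm_eq_inner inner_diff_left inner_diff_right inner_commute)
  then have "(norm (x - (\<chi> i. z)))\<^sup>2 = (\<Sum>i\<in>UNIV. (norm (x $ i - ?m))\<^sup>2)
      + 2 * ((\<Sum>i\<in>UNIV. x $ i - ?m) \<bullet> (?m - z)) + real CARD('n) * (norm (?m - z))\<^sup>2"
    by (simp add: norm_vec_power2 sum.distrib inner_sum_left sum_distrib_left)
  then show ?thesis unfolding m by (simp add: norm_vec_power2)
qed

lemma norm_diff_stack_mono:
  fixes x :: "('a::real_inner)^'n"
  assumes "norm (block_mean x - y) \<le> norm (block_mean x - z)"
  shows "norm (x - (\<chi> i. y)) \<le> norm (x - (\<chi> i. z))"
proof -
  have "(norm (block_mean x - y))\<^sup>2 \<le> (norm (block_mean x - z))\<^sup>2"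
    using assms by (intro power_mono) auto
  then have "(norm (x - (\<chi> i. y)))\<^sup>2 \<le> (norm (x - (\<chi> i. z)))\<^sup>2"
    unfolding norm_diff_stack_power2[of x y] norm_diff_stack_power2[of x z]
    by (intro add_left_mono mult_left_mono) auto
  then show ?thesis by (simp add: power2_le_iff_abs_le)
qed

lemma nearest_point_block_mean:
  fixes x :: "('a::real_inner)^'n"
  assumes "y \<in> nearest_points M (block_mean x)" "z \<in> M"
  shows "norm (x - (\<chi> i. y)) \<le> norm (x - (\<chi> i. z))"
  using assms by (intro norm_diff_stack_mono) (simp add: nearest_points_iff norm_minus_commute)

text \<open>The consensus set consists of the stacked copies of points of \<open>M\<close>, so the nearest one is found
  by projecting the mean.\<close>

lemma infdist_consensus_set:
  fixes x :: "('a::real_inner)^'n"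
  assumes y: "y \<in> nearest_points M (block_mean x)"
  shows "infdist x (consensus_set M) = norm (x - (\<chi> i. y))"
proof -
  have C: "consensus_set M = (\<lambda>z. (\<chi> i. z) :: 'a^'n) ` M"
  proof
    show "consensus_set M \<subseteq> (\<lambda>z. (\<chi> i. z) :: 'a^'n) ` M"
    proof
      fix w :: "'a^'n" assume w: "w \<in> consensus_set M"
      then have "w = (\<chi> i. w $ undefined)" "w $ undefined \<in> M"
        by (auto simp: consensus_set_def vec_eq_iff)
      then show "w \<in> (\<lambda>z. \<chi> i. z) ` M" by blast
    qed
  qed (auto simp: consensus_set_def)
  have "(\<chi> i. y) \<in> nearest_points (consensus_set M) x"
    using nearest_point_block_mean[OF y] y
    by (auto simp: C nearest_points_iff norm_minus_commute)
  from nearest_points_infdist[OF this] show ?thesis by (simp add: norm_minus_commute)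
qed

section \<open>Linear convergence\<close>

lemma projected_consensus_step:
  fixes x x' :: "('a::euclidean_space)^'n"
  assumes M: "compact M" "proximally_smooth R M" and W: "mixing_matrix E W"
    and \<gamma>: "0 < \<gamma>" "\<gamma> \<le> 1" and \<delta>: "\<delta> < R"
    and x': "\<And>i. x' $ i \<in>
           nearest_points M ((1 - \<gamma>) *\<^sub>R x $ i + \<gamma> *\<^sub>R (\<Sum>j\<in>UNIV. W $ i $ j *\<^sub>R x $ j))"
    and y: "y \<in> nearest_points M (block_mean x)"
    and y': "y' \<in> nearest_points M (block_mean x')"
    and near: "norm (x - (\<chi> i. y)) \<le> \<delta>"
  shows "norm (x' - (\<chi> i. y'))
    \<le> (R - R * \<gamma> * (1 - second_singular_value W)) / (R - \<delta>) * norm (x - (\<chi> i. y))"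
proof -
  let ?\<sigma> = "second_singular_value W" and ?m = "block_mean x"
  define v where "v = (\<chi> i. (1 - \<gamma>) *\<^sub>R x $ i + \<gamma> *\<^sub>R (\<Sum>j\<in>UNIV. W $ i $ j *\<^sub>R x $ j))"
  have row: "(\<Sum>j\<in>UNIV. W $ i $ j) = 1" and W0: "0 \<le> W $ i $ j" for i j
    using W by (auto simp: mixing_matrix_def doubly_stochastic_def)
  have \<sigma>: "0 \<le> ?\<sigma>" using W by (simp add: mixing_matrix_def)
  have "0 \<le> \<delta>" using near norm_ge_zero order_trans by blast
  then have R: "0 < R" using \<delta> by simp
  have yM: "y \<in> M" using y by (simp add: nearest_points_iff)
  have shift: "v $ i - c = (1 - \<gamma>) *\<^sub>R (x $ i - c) + \<gamma> *\<^sub>R (\<Sum>j\<in>UNIV. W $ i $ j *\<^sub>R (x $ j - c))"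
    for i c
  proof -
    have "(\<Sum>j\<in>UNIV. W $ i $ j *\<^sub>R (x $ j - c)) = (\<Sum>j\<in>UNIV. W $ i $ j *\<^sub>R x $ j) - c"
      by (simp add: scaleR_diff_right sum_subtractf row flip: scaleR_left.sum)
    then show ?thesis unfolding v_def by (simp only: vec_lambda_beta) (simp add: algebra_simps)
  qed
  have comp: "norm (x $ i - y) \<le> \<delta>" for i
    using Finite_Cartesian_Product.norm_nth_le[of "x - (\<chi> i. y)" i] near by simp
  have "norm (v $ i - y) \<le> \<delta>" for i
  proof -
    have "norm (\<Sum>j\<in>UNIV. W $ i $ j *\<^sub>R (x $ j - y)) \<le> (\<Sum>j\<in>UNIV. W $ i $ j * \<delta>)"
      using W0 comp by (intro sum_norm_le) (auto intro: mult_left_mono)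
    also have "\<dots> = \<delta>" by (simp add: row flip: sum_distrib_right)
    finally have "norm (v $ i - y) \<le> (1 - \<gamma>) * \<delta> + \<gamma> * \<delta>"
      unfolding shift using \<gamma> comp[of i]
      by (intro norm_triangle_le add_mono) (auto intro: mult_left_mono)
    then show ?thesis by (simp add: algebra_simps)
  qed
  then have dv: "infdist (v $ i) M \<le> \<delta>" for i
    using infdist_le2[OF yM] by (simp add: dist_norm)
  have dm: "infdist ?m M \<le> \<delta>"
  proof -
    have "?m - y = (1 / real CARD('n)) *\<^sub>R (\<Sum>i\<in>UNIV. x $ i - y)"
      by (simp add: block_mean_def sum_subtractf scaleR_diff_right sum_constant_scaleR)
    moreover have "norm (\<Sum>i\<in>UNIV. x $ i - y) \<le> (\<Sum>i\<in>(UNIV :: 'n set). \<delta>)"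
      using comp by (intro sum_norm_le) auto
    ultimately have "norm (?m - y) \<le> \<delta>" by (simp add: field_simps)
    then show ?thesis using infdist_le2[OF yM] by (simp add: dist_norm)
  qed
  have xv: "x' $ i \<in> nearest_points M (v $ i)" for i using x' by (simp add: v_def)
  have contr: "norm (v - (\<chi> i. ?m)) \<le> (1 - \<gamma> * (1 - ?\<sigma>)) * norm (x - (\<chi> i. y))"
  proof -
    let ?e = "x - (\<chi> i. ?m)"
    have "(\<Sum>i\<in>UNIV. ?e $ i) = 0"
      by (simp add: sum_subtractf block_mean_def sum_constant_scaleR)
    then have *: "norm (\<chi> i. \<Sum>j\<in>UNIV. W $ i $ j *\<^sub>R ?e $ j) \<le> ?\<sigma> * norm ?e"
      by (rule block_norm_bound[OF W])
    have "v - (\<chi> i. ?m) = (1 - \<gamma>) *\<^sub>R ?e + \<gamma> *\<^sub>R (\<chi> i. \<Sum>j\<in>UNIV. W $ i $ j *\<^sub>R ?e $ j)"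
      by (simp add: vec_eq_iff shift)
    then have "norm (v - (\<chi> i. ?m)) \<le> (1 - \<gamma>) * norm ?e + \<gamma> * (?\<sigma> * norm ?e)"
      using \<gamma> * by (auto intro!: norm_triangle_le add_mono mult_left_mono)
    also have "\<dots> = (1 - \<gamma> * (1 - ?\<sigma>)) * norm ?e" by (simp add: algebra_simps)
    also have "\<dots> \<le> (1 - \<gamma> * (1 - ?\<sigma>)) * norm (x - (\<chi> i. y))"
    proof (rule mult_left_mono)
      show "norm ?e \<le> norm (x - (\<chi> i. y))" by (rule norm_diff_stack_mono) simp
      have "\<gamma> * (1 - ?\<sigma>) \<le> 1 * 1"
        using \<gamma> \<sigma> W by (intro mult_mono) (auto simp: mixing_matrix_def)
      then show "0 \<le> 1 - \<gamma> * (1 - ?\<sigma>)" by simp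
    qed
    finally show ?thesis .
  qed
  have "norm (x' - (\<chi> i. y')) \<le> norm (x' - (\<chi> i. y))"
    using y' yM by (rule nearest_point_block_mean)
  also have "\<dots> \<le> R / (R - \<delta>) * norm (v - (\<chi> i. ?m))"
    using nearest_points_Lipschitz[OF M \<delta> dv xv dm y] R \<delta> by (intro norm_vec_mono) auto
  also have "\<dots> \<le> R / (R - \<delta>) * ((1 - \<gamma> * (1 - ?\<sigma>)) * norm (x - (\<chi> i. y)))"
    using contr R \<delta> by (intro mult_left_mono) auto
  also have "\<dots> = (R - R * \<gamma> * (1 - ?\<sigma>)) / (R - \<delta>) * norm (x - (\<chi> i. y))"
    by (simp add: right_diff_distrib mult.assoc)
  finally show ?thesis .
qed

theorem theorem3p3:
  fixes M :: "(real^'r^'d) set"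
    and W :: "real^'n^'n" and E :: "('n \<times> 'n) set"
    and R \<gamma> \<delta> \<rho>1 :: real
    and x :: "nat \<Rightarrow> real^'r^'d^'n" and xbar :: "nat \<Rightarrow> real^'r^'d"
  assumes "compact M" and "smooth_embedded_submanifold M"
    and "0 < R" and "proximally_smooth R M"
    and "mixing_matrix E W"
    and "0 < \<gamma>" and "\<gamma> \<le> 1"
    and "\<And>k i. x (Suc k) $ i \<in>
           nearest_points M ((1 - \<gamma>) *\<^sub>R x k $ i + \<gamma> *\<^sub>R (\<Sum>j\<in>UNIV. W $ i $ j *\<^sub>R x k $ j))"
    and "\<And>k. xbar k \<in> nearest_points M (block_mean (x k))"
    and "x 0 \<in> consensus_nbhd M \<delta>"
    and "\<delta> < min (R * \<gamma> * (1 - second_singular_value W)) (R / 4)"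
    and "\<rho>1 = (R - R * \<gamma> * (1 - second_singular_value W)) / (R - \<delta>)"
  shows "\<rho>1 < 1 \<and>
    converges_linearly_to_set x (consensus_set M) \<rho>1 \<and>
    (\<forall>k. norm (x (Suc k) - (\<chi> i. xbar (Suc k))) \<le> \<rho>1 * norm (x k - (\<chi> i. xbar k)))"
proof -
  let ?\<sigma> = "second_singular_value W"
  define D where "D k = norm (x k - (\<chi> i. xbar k))" for k
  have D0: "D 0 \<le> \<delta>"
  proof -
    obtain y where "y \<in> nearest_points M (block_mean (x 0))" "norm (x 0 - (\<chi> i. y)) \<le> \<delta>"
      using assms(10) by (auto simp: consensus_nbhd_def)
    moreover from this have "D 0 \<le> norm (x 0 - (\<chi> i. y))"
      unfolding D_def using nearest_point_block_mean[OF assms(9)] by (simp add: nearest_points_iff)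
    ultimately show ?thesis by simp
  qed
  have \<delta>: "\<delta> < R" using assms(3,11) by simp
  have \<rho>: "\<rho>1 < 1" using assms(11) \<delta> unfolding assms(12) by (simp add: field_simps)
  have "\<gamma> * (1 - ?\<sigma>) \<le> 1 * 1"
    using assms(5-7) by (intro mult_mono) (auto simp: mixing_matrix_def)
  then have "R * (\<gamma> * (1 - ?\<sigma>)) \<le> R" using assms(3) by simp
  then have \<rho>0: "0 \<le> \<rho>1" unfolding assms(12) using \<delta> by (simp add: mult.assoc)
  have step: "D (Suc k) \<le> \<rho>1 * D k" if "D k \<le> \<delta>" for k
    unfolding D_def assms(12)
    using projected_consensus_step[OF assms(1,4-7) \<delta> assms(8,9,9)] that unfolding D_def .
  have inv: "D k \<le> \<delta>" for k
  proof (induction k)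
    case (Suc k)
    have "D (Suc k) \<le> \<rho>1 * D k" using Suc by (rule step)
    also have "\<dots> \<le> 1 * D k" using \<rho> by (intro mult_right_mono) (auto simp: D_def)
    finally show ?case using Suc by simp
  qed (rule D0)
  have contr: "D (Suc k) \<le> \<rho>1 * D k" for k using inv by (rule step)
  have geo: "D k \<le> \<rho>1 ^ k * D 0" for k
  proof (induction k)
    case (Suc k)
    have "D (Suc k) \<le> \<rho>1 * D k" by (rule contr)
    also have "\<dots> \<le> \<rho>1 * (\<rho>1 ^ k * D 0)" using Suc \<rho>0 by (intro mult_left_mono)
    finally show ?case by simp
  qed simp
  have "(\<lambda>k. \<rho>1 ^ k * D 0) \<longlonglongrightarrow> 0"
    using \<rho> \<rho>0 by (intro tendsto_mult_left_zero LIMSEQ_realpow_zero)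
  then have "D \<longlonglongrightarrow> 0"
    by (rule tendsto_sandwich[OF always_eventually always_eventually tendsto_const, rotated 2])
      (auto simp: geo, simp add: D_def)
  moreover have "infdist (x k) (consensus_set M) = D k" for k
    unfolding D_def using assms(9) by (rule infdist_consensus_set)
  ultimately show ?thesis
    using \<rho> contr unfolding converges_linearly_to_set_def D_def by auto
qed

end
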